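(* Let $\Sigma$ be a finite alphabet. The class $\mathcal{S}^{rat}_{\mathbb{R}_{\ge0}}(\Sigma^* )$ of stochastic regular languages is the smallest class of quantitative languages over $\Sigma$ that contains all Dirac distributions $\{\delta_\sigma\mid\sigma\in\Sigma\}$ and is closed under convex combinations, Cauchy products, and discounted Kleene star.
   Context: A quantitative language over $\Sigma$ is a function $f:\Sigma^*\to\mathbb{R}$. It is stochastic if $f(w)\ge0$ for all $w\in\Sigma^*$ and $\sum_{w\in\Sigma^*}f(w)=1$. A weighted automaton over $\mathbb{R}_{\ge0}$ is a tuple $\mathcal{W}=(\Sigma,Q,\lambda,M,\mu)$ with $Q$ a finite set of states, $\lambda\in\mathbb{R}_{\ge0}^Q$ the initial weight vector, $M_\sigma\in\mathbb{R}_{\ge0}^{Q\times Q}$ a transition matrix for each $\sigma\in\Sigma$, and $\mu\in\mathbb{R}_{\ge0}^Q$ the final weight vector; its semantics is $\llbracket\mathcal{W}\rrbracket(w_1\cdots w_n)=\lambda^\top M_{w_1}\cdots M_{w_n}\mu$. $\mathcal{S}^{rat}_{\mathbb{R}_{\ge0}}(\Sigma^* )$ is the set of stochastic languages over $\Sigma^*$ of the form $\llbracket\mathcal{W}\rrbracket$ for such $\mathcal{W}$. For a letter $\sigma\in\Sigma$, $\delta_\sigma$ is the function equal to $1$ on the one-letter word $\sigma$ and $0$ on all other words. Operations, for stochastic languages $f_1,f_2$ and $\alpha\in(0,1)$: 1. Convex combination: $(\alpha f_1+(1-\alpha)f_2)(w)=\alpha f_1(w)+(1-\alpha)f_2(w)$.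 2. Cauchy product: $(f_1\cdot f_2)(w)=\sum_{w=uv}f_1(u)f_2(v)$. 3. Discounted Kleene star: $$(f_1)^*_\alpha(w)=\sum_{k=1}^\infty\ \sum_{\substack{w_1,\ldots,w_k\in\Sigma^+\\ w=w_1\cdots w_k}}\alpha(1-\alpha)^{k-1}\prod_{i=1}^k f_1(w_i),$$ where $\Sigma^+$ is the set of non-empty words; the definition implicitly sets $f_1(\varepsilon)=0$ for the empty word $\varepsilon$.
   Formalization: As δ_ε is stochastic regular but not generated by the δ_σ, two corrected forms are proved for non-empty Σ: the δ_σ generate the stochastic regular languages with f(ε)=0, and the δ_σ with δ_ε generate all of them; the star is applied only to f with f(ε)=0. *)

theory Defs
  imports "HOL-Analysis.Infinite_Sum"
begin

text \<open>The alphabet is a finite type \<open>'a\<close>, and words are lists over it.\<close>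

type_synonym 'a qlang = "'a list \<Rightarrow> real"

definition stochastic :: "'a qlang \<Rightarrow> bool" where
  "stochastic f \<longleftrightarrow> (\<forall>w. 0 \<le> f w) \<and> (f has_sum 1) UNIV"


subsection \<open>Weighted automata over the nonnegative reals\<close>

record ('q, 'a) weighted_automaton =
  states :: "'q set"
  init   :: "'q \<Rightarrow> real"
  trans  :: "'a \<Rightarrow> 'q \<Rightarrow> 'q \<Rightarrow> real"
  final  :: "'q \<Rightarrow> real"

definition weighted_automaton :: "('q, 'a) weighted_automaton \<Rightarrow> bool" where
  "weighted_automaton W \<longleftrightarrow>
     finite (states W) \<and>
     (\<forall>q\<in>states W. 0 \<le> init W q) \<and>
     (\<forall>\<sigma>. \<forall>p\<in>states W. \<forall>q\<in>states W. 0 \<le> trans W \<sigma> p q) \<and>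
     (\<forall>q\<in>states W. 0 \<le> final W q)"

text \<open>\<open>word_vec W w\<close> is the column vector \<open>M\<^sub>w\<^sub>1 \<cdots> M\<^sub>w\<^sub>n \<mu>\<close> for \<open>w = w\<^sub>1 \<dots> w\<^sub>n\<close>, multiplied out
  from the right. Only the values of the components at states matter.\<close>

primrec word_vec :: "('q, 'a) weighted_automaton \<Rightarrow> 'a list \<Rightarrow> 'q \<Rightarrow> real" where
  "word_vec W [] = final W"
| "word_vec W (\<sigma> # w) = (\<lambda>p. \<Sum>q\<in>states W. trans W \<sigma> p q * word_vec W w q)"

definition semantics :: "('q, 'a) weighted_automaton \<Rightarrow> 'a qlang" where
  "semantics W w = (\<Sum>q\<in>states W. init W q * word_vec W w q)"

text \<open>States are drawn from \<open>nat\<close>; by \<open>stochastic_regularI\<close> below, automata with a finite set of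
  states of any other type give nothing more.\<close>

definition stochastic_regular :: "'a qlang set" where
  "stochastic_regular =
     {f. stochastic f \<and>
         (\<exists>W :: (nat, 'a) weighted_automaton. weighted_automaton W \<and> f = semantics W)}"

lemma stochastic_regularI:
  fixes W :: "('q, 'a) weighted_automaton"
  assumes W: "weighted_automaton W" and st: "stochastic (semantics W)"
  shows "semantics W \<in> stochastic_regular"
proof -
  have fin: "finite (states W)"
    using W by (simp add: weighted_automaton_def)
  then obtain g :: "'q \<Rightarrow> nat" where g: "inj_on g (states W)"
    using finite_imp_inj_to_nat_seg by metis
  define h where "h = the_inv_into (states W) g"
  have h: "h (g q) = q" if "q \<in> states W" for q
    using g that by (simp add: h_def the_inv_into_f_f)
  define V where "V = \<lparr>states = g ` states W, init = init W \<circ> h,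
    trans = (\<lambda>\<sigma> p q. trans W \<sigma> (h p) (h q)), final = final W \<circ> h\<rparr>"
  have "weighted_automaton V"
    using W by (auto simp: weighted_automaton_def V_def h)
  have vec: "word_vec V w (g q) = word_vec W w q" if "q \<in> states W" for w q
    using that
    by (induction w arbitrary: q) (auto simp: V_def sum.reindex[OF g] h intro!: sum.cong)
  have "semantics V = semantics W"
  proof
    fix w
    have "semantics V w = (\<Sum>q\<in>states W. init V (g q) * word_vec V w (g q))"
      by (simp add: semantics_def sum.reindex[OF g] V_def)
    also have "\<dots> = semantics W w"
      unfolding semantics_def by (intro sum.cong refl) (simp add: vec, simp add: V_def h)
    finally show "semantics V w = semantics W w" .
  qed
  then show ?thesis
    using st \<open>weighted_automaton V\<close> unfolding stochastic_regular_def by (auto intro!: exI[of _ V])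
qed


subsection \<open>Operations\<close>

definition dirac :: "'a list \<Rightarrow> 'a qlang" where
  "dirac u w = (if w = u then 1 else 0)"

definition convex_comb :: "real \<Rightarrow> 'a qlang \<Rightarrow> 'a qlang \<Rightarrow> 'a qlang" where
  "convex_comb \<alpha> f g w = \<alpha> * f w + (1 - \<alpha>) * g w"

definition cauchy_product :: "'a qlang \<Rightarrow> 'a qlang \<Rightarrow> 'a qlang" where
  "cauchy_product f g w = (\<Sum>(u, v)\<in>{(u, v). w = u @ v}. f u * g v)"

text \<open>The outer index is shifted by one. The inner sum ranges over a finite set, which is empty
  as soon as \<open>k\<close> reaches the length of \<open>w\<close>.\<close>

definition discounted_star :: "real \<Rightarrow> 'a qlang \<Rightarrow> 'a qlang" where
  "discounted_star \<alpha> f w =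
     (\<Sum>k. \<Sum>ws\<in>{ws. length ws = Suc k \<and> [] \<notin> set ws \<and> w = concat ws}.
        \<alpha> * (1 - \<alpha>) ^ k * prod_list (map f ws))"

text \<open>The operations are defined for stochastic languages only, and the star moreover only for
  languages that vanish at the empty word: if \<open>f [] > 0\<close>, the total mass of
  \<open>discounted_star \<alpha> f\<close> is less than 1.\<close>

definition closed_under_ops :: "'a qlang set \<Rightarrow> bool" where
  "closed_under_ops C \<longleftrightarrow>
     (\<forall>f\<in>C. \<forall>g\<in>C. \<forall>\<alpha>\<in>{0<..<1}.
        stochastic f \<longrightarrow> stochastic g \<longrightarrow> convex_comb \<alpha> f g \<in> C) \<and>
     (\<forall>f\<in>C. \<forall>g\<in>C. stochastic f \<longrightarrow> stochastic g \<longrightarrow> cauchy_product f g \<in> C) \<and>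
     (\<forall>f\<in>C. \<forall>\<alpha>\<in>{0<..<1}.
        stochastic f \<longrightarrow> f [] = 0 \<longrightarrow> discounted_star \<alpha> f \<in> C)"

definition is_smallest_closed_class :: "'a qlang set \<Rightarrow> 'a qlang set \<Rightarrow> bool" where
  "is_smallest_closed_class G S \<longleftrightarrow>
     G \<subseteq> S \<and> closed_under_ops S \<and> (\<forall>C. G \<subseteq> C \<and> closed_under_ops C \<longrightarrow> S \<subseteq> C)"

abbreviation letter_diracs :: "'a qlang set" where
  "letter_diracs \<equiv> {dirac [\<sigma>] | \<sigma>. True}"


subsection \<open>The role of the empty word\<close>

text \<open>\<open>dirac []\<close> is stochastic and regular, but everything generated from \<open>letter_diracs\<close>
  vanishes at the empty word. The characterisation therefore needs either the restriction to
  languages with \<open>f [] = 0\<close> or \<open>dirac []\<close> as an additional generator.\<close>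

lemma stochastic_dirac: "stochastic (dirac u)"
proof -
  have "(dirac u has_sum (\<Sum>w\<in>{u}. dirac u w)) {u}"
    by (rule has_sum_finite) simp
  then have "(dirac u has_sum 1) {u}"
    by (simp add: dirac_def)
  then have "(dirac u has_sum 1) UNIV"
    by (rule has_sum_cong_neutral[THEN iffD1, rotated -1]) (auto simp: dirac_def)
  then show ?thesis
    by (auto simp: stochastic_def dirac_def)
qed

lemma dirac_Nil_stochastic_regular: "dirac [] \<in> stochastic_regular"
proof -
  define W :: "(nat, 'a) weighted_automaton" where
    "W = \<lparr>states = {0}, init = (\<lambda>_. 1), trans = (\<lambda>_ _ _. 0), final = (\<lambda>_. 1)\<rparr>"
  have "semantics W = dirac []"
  proof
    fix w show "semantics W w = dirac [] w"
      by (cases w) (simp_all add: semantics_def W_def dirac_def)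
  qed
  moreover have "weighted_automaton W"
    by (simp add: weighted_automaton_def W_def)
  ultimately show ?thesis
    using stochastic_regularI[of W] stochastic_dirac[of "[]"] by simp
qed

lemma not_smallest_closed_class_letters:
  "\<not> is_smallest_closed_class letter_diracs stochastic_regular"
proof
  assume least: "is_smallest_closed_class letter_diracs (stochastic_regular :: 'a qlang set)"
  define C :: "'a qlang set" where "C = {f. f [] = 0}"
  have "{(u, v). [] = u @ v} = {([], [] :: 'a list)}"
    by auto
  moreover have "discounted_star \<alpha> f [] = 0" for \<alpha> and f :: "'a qlang"
  proof -
    have "{ws :: 'a list list. length ws = Suc k \<and> [] \<notin> set ws \<and> [] = concat ws} = {}" for k
      by (auto simp: length_Suc_conv)
    then show ?thesis
      unfolding discounted_star_def by (simp only: sum.empty suminf_zero)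
  qed
  ultimately have "closed_under_ops C"
    by (simp add: closed_under_ops_def C_def convex_comb_def cauchy_product_def)
  moreover have "letter_diracs \<subseteq> C"
    by (auto simp: C_def dirac_def)
  ultimately have "dirac [] \<in> C"
    using least dirac_Nil_stochastic_regular unfolding is_smallest_closed_class_def by blast
  then show False
    by (simp add: C_def dirac_def)
qed

end

theory Submission
  imports Defs "HOL-Analysis.Elementary_Metric_Spaces"
begin

text \<open>For minimality, let \<open>C\<close> contain the letters and be closed under the operations. The nonnegative
  multiples of the stochastic languages in \<open>C\<close> that vanish at the empty word form a convex cone that
  is also closed under Cauchy products. Away from the empty word, the languages \<open>F\<^sub>p\<close> accepted from
  the states \<open>p\<close> of an automaton satisfy a linear system \<open>F\<^sub>p = b\<^sub>p + \<Sum>\<^sub>q a\<^sub>p\<^sub>q \<cdot> F\<^sub>q\<close> with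
  coefficients in this cone, and Gaussian elimination keeps the coefficients there: in
  \<open>F\<^sub>r = b + a \<cdot> F\<^sub>r\<close> with \<open>F\<^sub>r \<noteq> 0\<close> of finite mass, comparing masses forces \<open>a\<close> to have mass
  \<open>c < 1\<close>, so that \<open>a + a \<cdot> a + \<dots>\<close> is a multiple of a star discounted by \<open>1 - c\<close>. No
  trimming of the automaton is needed beyond dropping the states whose language is zero or has
  infinite mass.\<close>

subsection \<open>Cauchy products\<close>

notation cauchy_product (infixl "\<cdot>" 70)

lemma splits_Cons:
  "{(u, v). a # w = u @ v} = insert ([], a # w) ((\<lambda>(u, v). (a # u, v)) ` {(u, v). w = u @ v})"
  by (auto simp: Cons_eq_append_conv image_iff)

lemma finite_splits: "finite {(u, v). w = u @ v}"
proof (induction w)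
  case Nil
  show ?case
    by simp
next
  case (Cons a w)
  show ?case
    by (simp only: splits_Cons finite_insert Cons finite_imageI)
qed

lemma cauchy_Nil [simp]: "(f \<cdot> g) [] = f [] * g []"
proof -
  have "{(u, v). [] = u @ v} = {([], [] :: 'a list)}"
    by auto
  then show ?thesis
    by (simp add: cauchy_product_def)
qed

text \<open>Either the left factor is empty, or it takes the letter \<open>a\<close> and leaves a
  product with the left derivative of \<open>f\<close>. Facts about products thus become inductions
  over words with the left factor generalised.\<close>

lemma cauchy_Cons: "(f \<cdot> g) (a # w) = f [] * g (a # w) + ((\<lambda>u. f (a # u)) \<cdot> g) w"
  unfolding cauchy_product_def splits_Cons
  by (subst sum.insert[OF finite_imageI[OF finite_splits]])
    (auto simp: sum.reindex inj_on_def case_prod_unfold)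

lemma cauchy_add_left: "((\<lambda>u. f u + g u) \<cdot> h) w = (f \<cdot> h) w + (g \<cdot> h) w"
  by (simp add: cauchy_product_def case_prod_unfold algebra_simps sum.distrib)

lemma cauchy_add_right: "(h \<cdot> (\<lambda>u. f u + g u)) w = (h \<cdot> f) w + (h \<cdot> g) w"
  by (simp add: cauchy_product_def case_prod_unfold algebra_simps sum.distrib)

lemma cauchy_scale_left: "((\<lambda>u. c * f u) \<cdot> h) w = c * (f \<cdot> h) w"
  by (simp add: cauchy_product_def case_prod_unfold algebra_simps sum_distrib_left)

lemma cauchy_scale_right: "(h \<cdot> (\<lambda>u. c * f u)) w = c * (h \<cdot> f) w"
  by (simp add: cauchy_product_def case_prod_unfold algebra_simps sum_distrib_left)

lemma cauchy_zero_left: "((\<lambda>u. 0) \<cdot> h) w = 0"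
  by (simp add: cauchy_product_def case_prod_unfold)

lemma cauchy_zero_right: "(h \<cdot> (\<lambda>u. 0)) w = 0"
  by (simp add: cauchy_product_def case_prod_unfold)

lemma cauchy_sum_left: "((\<lambda>u. \<Sum>i\<in>I. f i u) \<cdot> h) w = (\<Sum>i\<in>I. (f i \<cdot> h) w)"
  unfolding cauchy_product_def case_prod_unfold sum_distrib_right by (rule sum.swap)

lemma cauchy_sum_right: "(h \<cdot> (\<lambda>u. \<Sum>i\<in>I. f i u)) w = (\<Sum>i\<in>I. (h \<cdot> f i) w)"
  unfolding cauchy_product_def case_prod_unfold sum_distrib_left by (rule sum.swap)

lemma cauchy_dirac_Nil_right: "f \<cdot> dirac [] = f"
proof
  show "(f \<cdot> dirac []) w = f w" for w
    by (induction w arbitrary: f) (simp_all add: cauchy_Cons dirac_def)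
qed

text \<open>Reading a letter is multiplication by its Dirac language, so transitions can serve as
  coefficients of a linear system.\<close>

lemma cauchy_dirac_letter_Cons: "(dirac [a] \<cdot> f) (b # w) = (if a = b then f w else 0)"
proof -
  have "(\<lambda>u. dirac [a] (b # u)) = (if a = b then dirac [] else (\<lambda>u. 0))"
    by (auto simp: dirac_def)
  moreover have "(dirac [] \<cdot> f) w = f w"
    by (cases w) (simp_all add: cauchy_Cons cauchy_zero_left dirac_def)
  ultimately show ?thesis
    by (simp add: cauchy_Cons cauchy_zero_left) (simp add: dirac_def)
qed

lemma cauchy_assoc: "f \<cdot> g \<cdot> h = f \<cdot> (g \<cdot> h)"
proof
  show "(f \<cdot> g \<cdot> h) w = (f \<cdot> (g \<cdot> h)) w" for w
    by (induction w arbitrary: f)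
      (simp_all add: cauchy_Cons cauchy_add_left cauchy_scale_left algebra_simps)
qed

lemma cauchy_nonneg: "(\<And>w. 0 \<le> f w) \<Longrightarrow> (\<And>w. 0 \<le> g w) \<Longrightarrow> 0 \<le> (f \<cdot> g) w"
  unfolding cauchy_product_def by (intro sum_nonneg) (simp add: case_prod_unfold)

text \<open>With \<open>f [] = 0\<close>, every contributing split leaves a right factor strictly
  shorter than \<open>w\<close>.\<close>

lemma cauchy_cong_shorter:
  assumes "f [] = 0" and "\<And>v. length v < length w \<Longrightarrow> g v = h v"
  shows "(f \<cdot> g) w = (f \<cdot> h) w"
  unfolding cauchy_product_def
proof (rule sum.cong)
  fix x assume "x \<in> {(u, v). w = u @ v}"
  then show "(case x of (u, v) \<Rightarrow> f u * g v) = (case x of (u, v) \<Rightarrow> f u * h v)"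
    using assms by (cases "fst x") auto
qed simp

text \<open>Uniqueness in Arden's rule: as \<open>a [] = 0\<close>, the equation determines the
  value at \<open>w\<close> from the values at shorter words.\<close>

lemma arden_unique:
  assumes "a [] = 0"
    and f: "\<And>w. f w = b w + (a \<cdot> f) w" and g: "\<And>w. g w = b w + (a \<cdot> g) w"
  shows "f = g"
proof
  show "f w = g w" for w
  proof (induction w rule: length_induct)
    case (1 w)
    then show ?case
      using cauchy_cong_shorter[of a w f g] assms(1) f[of w] g[of w] by auto
  qed
qed

subsection \<open>Total mass\<close>

text \<open>A form of Tonelli's theorem: for nonnegative terms, an iterated sum already gives the
  sum over the product.\<close>

lemma has_sum_Times_nonneg:
  fixes f :: "'b \<Rightarrow> 'c \<Rightarrow> real"
  assumes nonneg: "\<And>x y. 0 \<le> f x y"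
    and row: "\<And>x. (f x has_sum g x) UNIV" and col: "(g has_sum s) UNIV"
  shows "((\<lambda>(x, y). f x y) has_sum s) (UNIV \<times> UNIV)"
proof (rule has_sum_SigmaI)
  show "((\<lambda>y. case (x, y) of (x, y) \<Rightarrow> f x y) has_sum g x) UNIV" for x
    using row by simp
  then show "(\<lambda>(x, y). f x y) summable_on UNIV \<times> UNIV"
    by (rule summable_on_SigmaI) (use nonneg col in \<open>auto simp: has_sum_imp_summable\<close>)
qed (rule col)

text \<open>Nonnegativity is built in, so that mass zero forces the zero language.\<close>

definition has_mass :: "'a qlang \<Rightarrow> real \<Rightarrow> bool" where
  "has_mass f c \<longleftrightarrow> (\<forall>w. 0 \<le> f w) \<and> (f has_sum c) UNIV"

lemma stochastic_iff_has_mass: "stochastic f \<longleftrightarrow> has_mass f 1"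
  by (simp add: stochastic_def has_mass_def)

lemma has_mass_nonneg: "has_mass f c \<Longrightarrow> 0 \<le> c"
  unfolding has_mass_def by (auto intro: has_sum_nonneg)

lemma has_mass_unique: "has_mass f c \<Longrightarrow> has_mass f d \<Longrightarrow> c = d"
  unfolding has_mass_def by (auto intro: has_sum_unique)

lemma has_mass_add: "has_mass f c \<Longrightarrow> has_mass g d \<Longrightarrow> has_mass (\<lambda>w. f w + g w) (c + d)"
  unfolding has_mass_def by (auto intro: has_sum_add)

lemma has_mass_scale: "has_mass f c \<Longrightarrow> 0 \<le> k \<Longrightarrow> has_mass (\<lambda>w. k * f w) (k * c)"
  unfolding has_mass_def by (auto intro: has_sum_cmult_right)

lemma has_mass_zero_iff: "has_mass f 0 \<longleftrightarrow> f = (\<lambda>w. 0)"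
proof
  assume "has_mass f 0"
  then show "f = (\<lambda>w. 0)"
    using nonneg_has_sum_le_0D[of f UNIV 0] by (auto simp: has_mass_def)
qed (simp add: has_mass_def)

lemma has_mass_cauchy:
  assumes f: "has_mass f c" and g: "has_mass g d"
  shows "has_mass (f \<cdot> g) (c * d)"
proof -
  have fg: "\<And>w. 0 \<le> f w" "\<And>w. 0 \<le> g w" "(f has_sum c) UNIV" "(g has_sum d) UNIV"
    using f g by (auto simp: has_mass_def)
  have "((\<lambda>(u, v). f u * g v) has_sum c * d) (UNIV \<times> UNIV)"
    by (rule has_sum_Times_nonneg[where g = "\<lambda>u. f u * d"])
      (use fg in \<open>auto intro: has_sum_cmult_right has_sum_cmult_left\<close>)
  \<comment> \<open>The pairs are regrouped by the word that they spell; each group is then a finite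
    sum, namely one value of the Cauchy product.\<close>
  moreover have "((\<lambda>(u, v). f u * g v) has_sum c * d) (UNIV \<times> UNIV) \<longleftrightarrow>
      ((\<lambda>(w, u, v). f u * g v) has_sum c * d) (SIGMA w:UNIV. {(u, v). w = u @ v})"
    by (rule has_sum_reindex_bij_witness[where i = snd and j = "\<lambda>(u, v). (u @ v, u, v)"]) auto
  ultimately have "((\<lambda>(w, u, v). f u * g v) has_sum c * d) (SIGMA w:UNIV. {(u, v). w = u @ v})"
    by simp
  then have "((f \<cdot> g) has_sum c * d) UNIV"
    by (rule has_sum_SigmaD) (simp add: cauchy_product_def finite_splits has_sum_finite)
  then show ?thesis
    using fg cauchy_nonneg[of f g] by (auto simp: has_mass_def)
qed

lemma stochastic_convex_comb:
  assumes "stochastic f" "stochastic g" "0 < \<alpha>" "\<alpha> < 1"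
  shows "stochastic (convex_comb \<alpha> f g)"
proof -
  have "has_mass (\<lambda>w. \<alpha> * f w + (1 - \<alpha>) * g w) (\<alpha> * 1 + (1 - \<alpha>) * 1)"
    using assms by (intro has_mass_add has_mass_scale) (auto simp: stochastic_iff_has_mass)
  then show ?thesis
    by (simp add: stochastic_iff_has_mass convex_comb_def[abs_def])
qed

lemma stochastic_cauchy: "stochastic f \<Longrightarrow> stochastic g \<Longrightarrow> stochastic (f \<cdot> g)"
  using has_mass_cauchy[of f 1 g 1] by (simp add: stochastic_iff_has_mass)

subsection \<open>Discounted star\<close>

primrec cauchy_power :: "'a qlang \<Rightarrow> nat \<Rightarrow> 'a qlang" where
  "cauchy_power f 0 = dirac []"
| "cauchy_power f (Suc k) = f \<cdot> cauchy_power f k"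

text \<open>The inner index set of \<open>discounted_star\<close>, where it occurs with
  \<open>Suc k\<close> for \<open>k\<close>.\<close>

definition factorizations :: "nat \<Rightarrow> 'a list \<Rightarrow> 'a list list set" where
  "factorizations k w = {ws. length ws = k \<and> [] \<notin> set ws \<and> w = concat ws}"

lemma factorizations_Suc:
  "factorizations (Suc k) w =
     (\<lambda>((u, v), ws). u # ws) ` (SIGMA (u, v):{(u, v). w = u @ v \<and> u \<noteq> []}. factorizations k v)"
  by (fastforce simp: factorizations_def length_Suc_conv image_iff)

lemma finite_factorizations: "finite (factorizations k w)"
proof (induction k arbitrary: w)
  case 0
  have "factorizations 0 w \<subseteq> {[]}"
    by (auto simp: factorizations_def)
  then show ?case
    by (rule finite_subset) simp
next
  case (Suc k)
  have "finite {(u, v). w = u @ v \<and> u \<noteq> []}"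
    by (rule finite_subset[OF _ finite_splits[of w]]) auto
  then show ?case
    unfolding factorizations_Suc using Suc by (intro finite_imageI finite_SigmaI) auto
qed

text \<open>A power sums over all factorizations; those with an empty factor have weight 0 because
  \<open>f [] = 0\<close>.\<close>

lemma cauchy_power_eq_sum_factorizations:
  assumes "f [] = 0"
  shows "cauchy_power f k w = (\<Sum>ws\<in>factorizations k w. prod_list (map f ws))"
proof (induction k arbitrary: w)
  case 0
  have "factorizations 0 w = (if w = [] then {[]} else {})"
    by (auto simp: factorizations_def)
  then show ?case
    by (simp add: dirac_def)
next
  case (Suc k)
  let ?I = "{(u, v). w = u @ v \<and> u \<noteq> []}"
  have fin: "finite ?I"
    by (rule finite_subset[OF _ finite_splits[of w]]) auto
  have "cauchy_power f (Suc k) w = (\<Sum>(u, v)\<in>?I. f u * cauchy_power f k v)"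
    unfolding cauchy_power.simps cauchy_product_def
    by (rule sum.mono_neutral_right) (auto simp: finite_splits assms)
  also have "\<dots> = (\<Sum>(u, v)\<in>?I. \<Sum>ws\<in>factorizations k v. prod_list (map f (u # ws)))"
    by (simp add: Suc sum_distrib_left case_prod_unfold)
  also have "\<dots> = (\<Sum>((u, v), ws)\<in>(SIGMA (u, v):?I. factorizations k v). prod_list (map f (u # ws)))"
    by (subst sum.Sigma[symmetric])
      (auto simp: fin[unfolded case_prod_unfold] finite_factorizations case_prod_unfold)
  also have "\<dots> = (\<Sum>ws\<in>factorizations (Suc k) w. prod_list (map f ws))"
    unfolding factorizations_Suc
    by (subst sum.reindex) (auto simp: inj_on_def case_prod_unfold factorizations_def)
  finally show ?case .
qed

lemma cauchy_power_long: "f [] = 0 \<Longrightarrow> length w < k \<Longrightarrow> cauchy_power f k w = 0"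
proof (induction k arbitrary: w)
  case (Suc k)
  have "(f \<cdot> cauchy_power f k) w = (f \<cdot> (\<lambda>v. 0)) w"
    by (rule cauchy_cong_shorter) (use Suc in auto)
  then show ?case
    by (simp add: cauchy_zero_right)
qed simp

lemma stochastic_cauchy_power: "stochastic f \<Longrightarrow> stochastic (cauchy_power f k)"
  by (induction k) (simp_all add: stochastic_dirac stochastic_cauchy)

text \<open>At a fixed word only finitely many powers are nonzero, so the series is an unconditional
  sum, which may later be exchanged with the sum over words.\<close>

lemma discounted_star_has_sum:
  assumes "f [] = 0"
  shows "((\<lambda>k. \<alpha> * (1 - \<alpha>) ^ k * cauchy_power f (Suc k) w) has_sum discounted_star \<alpha> f w) UNIV"
proof -
  let ?t = "\<lambda>k. \<alpha> * (1 - \<alpha>) ^ k * cauchy_power f (Suc k) w"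
  have zero: "?t k = 0" if "k \<notin> {..length w}" for k
    using cauchy_power_long[of f w "Suc k"] assms that by simp
  have "discounted_star \<alpha> f w = (\<Sum>k. ?t k)"
    unfolding discounted_star_def cauchy_power_eq_sum_factorizations[where f = f, OF assms] factorizations_def
    by (simp add: sum_distrib_left)
  also have "\<dots> = sum ?t {..length w}"
    by (rule suminf_finite) (use zero in auto)
  finally show ?thesis
    by (intro has_sum_finite_neutralI[where B = "{..length w}"]) (use zero in auto)
qed

text \<open>The star mixes stochastic powers with geometric weights of total 1; nonnegativity
  permits summing over words first.\<close>

lemma stochastic_discounted_star:
  assumes f: "stochastic f" "f [] = 0" and \<alpha>: "0 < \<alpha>" "\<alpha> < 1"
  shows "stochastic (discounted_star \<alpha> f)"
proof -
  let ?t = "\<lambda>k w. \<alpha> * (1 - \<alpha>) ^ k * cauchy_power f (Suc k) w"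
  have pow: "0 \<le> cauchy_power f k w" "(cauchy_power f k has_sum 1) UNIV" for k w
    using stochastic_cauchy_power[OF f(1), of k] by (auto simp: stochastic_def)
  have nonneg: "0 \<le> ?t k w" for k w
    using \<alpha> pow(1)[of "Suc k" w] by simp
  have row: "(?t k has_sum \<alpha> * (1 - \<alpha>) ^ k) UNIV" for k
    using has_sum_cmult_right[OF pow(2)[of "Suc k"], of "\<alpha> * (1 - \<alpha>) ^ k"] by simp
  have "(\<lambda>k. \<alpha> * (1 - \<alpha>) ^ k) sums (\<alpha> * (1 / (1 - (1 - \<alpha>))))"
    by (intro sums_mult geometric_sums) (use \<alpha> in auto)
  then have col: "((\<lambda>k. \<alpha> * (1 - \<alpha>) ^ k) has_sum 1) UNIV"
    using \<alpha> by (intro sums_nonneg_imp_has_sum) auto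
  have "((\<lambda>(k, w). ?t k w) has_sum 1) (UNIV \<times> UNIV)"
    by (rule has_sum_Times_nonneg[OF nonneg row col])
  then have "((\<lambda>(w, k). ?t k w) has_sum 1) (UNIV \<times> UNIV)"
    by (subst (asm) has_sum_swap) simp
  then have "(discounted_star \<alpha> f has_sum 1) UNIV"
    by (rule has_sum_SigmaD) (use discounted_star_has_sum[of f] f(2) in simp)
  moreover have "0 \<le> discounted_star \<alpha> f w" for w
    using discounted_star_has_sum[of f \<alpha> w] f(2) nonneg by (auto intro: has_sum_nonneg)
  ultimately show ?thesis
    by (simp add: stochastic_def)
qed

lemma discounted_star_Nil: "f [] = 0 \<Longrightarrow> discounted_star \<alpha> f [] = 0"
  using has_sum_unique[OF discounted_star_has_sum[of f \<alpha> "[]"]] by simp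

text \<open>Shifting the index: the term at \<open>Suc k\<close> is \<open>1 - \<alpha>\<close>
  times the product of \<open>f\<close> with the term at \<open>k\<close>. The star is used only
  through this linear equation, both to build its automaton and to solve equations.\<close>

lemma discounted_star_unfold:
  assumes f: "f [] = 0"
  shows "discounted_star \<alpha> f w = \<alpha> * f w + (1 - \<alpha>) * (f \<cdot> discounted_star \<alpha> f) w"
proof -
  let ?t = "\<lambda>k w. \<alpha> * (1 - \<alpha>) ^ k * cauchy_power f (Suc k) w"
  have star: "(\<lambda>k. ?t k w) sums discounted_star \<alpha> f w" for w
    by (rule has_sum_imp_sums[OF discounted_star_has_sum[of f, OF f]])
  have "(\<lambda>k. f u * ?t k v) sums (f u * discounted_star \<alpha> f v)" for u v
    by (rule sums_mult[OF star])
  then have "(\<lambda>k. (f \<cdot> ?t k) w) sums (f \<cdot> discounted_star \<alpha> f) w"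
    unfolding cauchy_product_def by (intro sums_sum) (auto simp: case_prod_unfold)
  then have "(\<lambda>k. (1 - \<alpha>) * (f \<cdot> ?t k) w) sums ((1 - \<alpha>) * (f \<cdot> discounted_star \<alpha> f) w)"
    by (rule sums_mult)
  moreover have "(1 - \<alpha>) * (f \<cdot> ?t k) w = ?t (Suc k) w" for k
    by (simp add: cauchy_scale_right)
  ultimately have "(\<lambda>k. ?t (Suc k) w) sums ((1 - \<alpha>) * (f \<cdot> discounted_star \<alpha> f) w)"
    by (simp only:)
  then have "(\<lambda>k. ?t k w) sums ((1 - \<alpha>) * (f \<cdot> discounted_star \<alpha> f) w + ?t 0 w)"
    by (subst (asm) sums_Suc_iff) simp
  from sums_unique2[OF star this] show ?thesis
    by (simp add: cauchy_dirac_Nil_right)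
qed

subsection \<open>Closure properties of regular languages\<close>

text \<open>The first transition matrix is absorbed into the initial vector. The automata for
  products and stars use this vector to start a new factor while reading its first letter.\<close>

lemma semantics_Cons:
  "semantics W (\<sigma> # w) =
     (\<Sum>q\<in>states W. (\<Sum>p\<in>states W. init W p * trans W \<sigma> p q) * word_vec W w q)"
  unfolding semantics_def word_vec.simps sum_distrib_left sum_distrib_right
  by (subst sum.swap) (simp add: mult.assoc)

lemma word_vec_nonneg: "weighted_automaton W \<Longrightarrow> p \<in> states W \<Longrightarrow> 0 \<le> word_vec W w p"
  by (induction w arbitrary: p) (auto simp: weighted_automaton_def intro!: sum_nonneg)

lemma stochastic_regular_dirac_letter: "dirac [\<sigma>] \<in> stochastic_regular"
proof -
  define W :: "(bool, 'a) weighted_automaton" where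
    "W = \<lparr>states = UNIV, init = (\<lambda>q. if q then 0 else 1),
      trans = (\<lambda>\<tau> p q. if \<tau> = \<sigma> \<and> \<not> p \<and> q then 1 else 0), final = (\<lambda>q. if q then 1 else 0)\<rparr>"
  have accepted: "word_vec W w True = dirac [] w" for w
    by (cases w) (simp_all add: W_def UNIV_bool dirac_def)
  have "semantics W w = dirac [\<sigma>] w" for w
    using accepted[of "tl w"]
    by (cases w) (simp_all add: semantics_def W_def UNIV_bool dirac_def)
  then have "semantics W = dirac [\<sigma>]"
    by blast
  moreover have "weighted_automaton W"
    by (simp add: weighted_automaton_def W_def)
  ultimately show ?thesis
    using stochastic_regularI[of W] stochastic_dirac[of "[\<sigma>]"] by simp
qed

lemma stochastic_regular_convex_comb:
  assumes f: "f \<in> stochastic_regular" and g: "g \<in> stochastic_regular"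
    and \<alpha>: "0 < \<alpha>" "\<alpha> < 1"
  shows "convex_comb \<alpha> f g \<in> stochastic_regular"
proof -
  obtain U V :: "(nat, 'a) weighted_automaton"
    where U: "weighted_automaton U" "f = semantics U"
      and V: "weighted_automaton V" "g = semantics V"
    using f g by (auto simp: stochastic_regular_def)
  define W where "W = \<lparr>states = states U <+> states V,
    init = case_sum (\<lambda>p. \<alpha> * init U p) (\<lambda>p. (1 - \<alpha>) * init V p),
    trans = (\<lambda>\<sigma>. case_sum (\<lambda>p. case_sum (trans U \<sigma> p) (\<lambda>_. 0))
                            (\<lambda>p. case_sum (\<lambda>_. 0) (trans V \<sigma> p))),
    final = case_sum (final U) (final V)\<rparr>"
  have fin: "finite (states U)" "finite (states V)"
    using U V by (auto simp: weighted_automaton_def)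
  have "weighted_automaton W"
    using U(1) V(1) \<alpha> by (auto simp: W_def weighted_automaton_def)
  moreover have "word_vec W w (Inl p) = word_vec U w p" for w p
    by (induction w arbitrary: p) (simp_all add: W_def sum.Plus fin)
  moreover have "word_vec W w (Inr p) = word_vec V w p" for w p
    by (induction w arbitrary: p) (simp_all add: W_def sum.Plus fin)
  ultimately have "semantics W w = convex_comb \<alpha> f g w" for w
    by (simp add: semantics_def U V convex_comb_def sum_distrib_left mult.assoc)
      (simp add: W_def sum.Plus fin mult.assoc)
  then have "semantics W = convex_comb \<alpha> f g"
    by blast
  then show ?thesis
    using stochastic_regularI[OF \<open>weighted_automaton W\<close>] stochastic_convex_comb[of f g \<alpha>] f g \<alpha>
    by (auto simp: stochastic_regular_def)
qed

lemma stochastic_regular_cauchy: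
  assumes f: "f \<in> stochastic_regular" and g: "g \<in> stochastic_regular"
  shows "f \<cdot> g \<in> stochastic_regular"
proof -
  obtain U V :: "(nat, 'a) weighted_automaton"
    where U: "weighted_automaton U" "f = semantics U"
      and V: "weighted_automaton V" "g = semantics V"
    using f g by (auto simp: stochastic_regular_def)
  \<comment> \<open>The silent move from a final state of \<open>U\<close> to an initial state of \<open>V\<close> is merged with the first
    letter read in \<open>V\<close>.\<close>
  define W where "W = \<lparr>states = states U <+> states V,
    init = case_sum (init U) (\<lambda>_. 0),
    trans = (\<lambda>\<sigma>. case_sum
      (\<lambda>p. case_sum (trans U \<sigma> p)
                     (\<lambda>q. final U p * (\<Sum>r\<in>states V. init V r * trans V \<sigma> r q)))
      (\<lambda>p. case_sum (\<lambda>_. 0) (trans V \<sigma> p))),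
    final = case_sum (\<lambda>p. final U p * g []) (final V)\<rparr>"
  have fin: "finite (states U)" "finite (states V)"
    using U V by (auto simp: weighted_automaton_def)
  have "0 \<le> g []"
    using g by (auto simp: stochastic_regular_def stochastic_def)
  then have "weighted_automaton W"
    using U(1) V(1) by (auto simp: W_def weighted_automaton_def intro!: mult_nonneg_nonneg sum_nonneg)
  have states_W: "states W = states U <+> states V"
    by (simp add: W_def)
  have trans_W: "trans W \<sigma> (Inl p) (Inl q) = trans U \<sigma> p q"
    "trans W \<sigma> (Inl p) (Inr q') = final U p * (\<Sum>r\<in>states V. init V r * trans V \<sigma> r q')"
    for \<sigma> p q q'
    by (simp_all add: W_def)
  have right: "word_vec W w (Inr p) = word_vec V w p" for w p
    by (induction w arbitrary: p) (simp_all add: W_def sum.Plus fin)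
  \<comment> \<open>At the empty word, stopping in \<open>U\<close> leaves the empty word to
    \<open>g\<close>, hence the final weight with \<open>g []\<close>. At
    \<open>\<sigma> # w\<close>, the term \<open>final U p * g (\<sigma> # w)\<close> is the weight
    of crossing over to \<open>V\<close> at once.\<close>
  have left: "word_vec W w (Inl p) = ((\<lambda>u. word_vec U u p) \<cdot> g) w" for w p
  proof (induction w arbitrary: p)
    case Nil
    show ?case
      by (simp add: W_def)
  next
    case (Cons \<sigma> w)
    have "((\<lambda>u. word_vec U u p) \<cdot> g) (\<sigma> # w) =
        final U p * g (\<sigma> # w) + (\<Sum>q\<in>states U. trans U \<sigma> p q * ((\<lambda>u. word_vec U u q) \<cdot> g) w)"
      by (simp add: cauchy_Cons cauchy_sum_left cauchy_scale_left)
    also have "final U p * g (\<sigma> # w) =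
        (\<Sum>q\<in>states V. trans W \<sigma> (Inl p) (Inr q) * word_vec W w (Inr q))"
      unfolding V(2) semantics_Cons right trans_W by (subst sum_distrib_left) (simp only: mult.assoc)
    also have "\<dots> + (\<Sum>q\<in>states U. trans U \<sigma> p q * ((\<lambda>u. word_vec U u q) \<cdot> g) w) =
        word_vec W (\<sigma> # w) (Inl p)"
      by (simp add: Cons states_W sum.Plus fin trans_W)
    finally show ?case
      by simp
  qed
  have "semantics W w = (f \<cdot> g) w" for w
  proof -
    have "semantics W w = (\<Sum>p\<in>states U. init U p * word_vec W w (Inl p))"
      unfolding semantics_def by (simp add: W_def sum.Plus fin)
    also have "\<dots> = (f \<cdot> g) w"
      unfolding left U(2) semantics_def[abs_def] by (simp add: cauchy_sum_left cauchy_scale_left)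
    finally show ?thesis .
  qed
  then have "semantics W = f \<cdot> g"
    by blast
  then show ?thesis
    using stochastic_regularI[OF \<open>weighted_automaton W\<close>] stochastic_cauchy[of f g] f g
    by (auto simp: stochastic_regular_def)
qed

lemma stochastic_regular_discounted_star:
  assumes f: "f \<in> stochastic_regular" "f [] = 0" and \<alpha>: "0 < \<alpha>" "\<alpha> < 1"
  shows "discounted_star \<alpha> f \<in> stochastic_regular"
proof -
  obtain U :: "(nat, 'a) weighted_automaton" where U: "weighted_automaton U" "f = semantics U"
    using f by (auto simp: stochastic_regular_def)
  let ?star = "discounted_star \<alpha> f"
  \<comment> \<open>\<open>h\<close> weighs what may follow a completed factor: either nothing or further factors.\<close>
  define h where "h = (\<lambda>w. \<alpha> * dirac [] w + (1 - \<alpha>) * ?star w)"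
  \<comment> \<open>At the end of a factor the run either stops, with weight
    \<open>\<alpha>\<close>, or restarts with weight \<open>1 - \<alpha>\<close> while reading the
    next letter.\<close>
  define W where "W = U\<lparr>
    trans := \<lambda>\<sigma> p q. trans U \<sigma> p q + final U p * (1 - \<alpha>) * (\<Sum>r\<in>states U. init U r * trans U \<sigma> r q),
    final := \<lambda>p. \<alpha> * final U p\<rparr>"
  have star: "?star = f \<cdot> h"
  proof
    show "?star w = (f \<cdot> h) w" for w
      using discounted_star_unfold[where f = f, OF f(2), of \<alpha> w]
      unfolding h_def cauchy_add_right cauchy_scale_right cauchy_dirac_Nil_right .
  qed
  have h_Nil: "h [] = \<alpha>"
    using discounted_star_Nil[where f = f, OF f(2), of \<alpha>] by (simp add: h_def dirac_def)
  \<comment> \<open>As \<open>f [] = 0\<close>, the next factor must begin with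
    \<open>\<sigma>\<close>; this is the restart transition of \<open>W\<close>.\<close>
  have h_Cons: "h (\<sigma> # w) = (1 - \<alpha>) * (\<Sum>q\<in>states U. (\<Sum>r\<in>states U. init U r * trans U \<sigma> r q) *
      ((\<lambda>u. word_vec U u q) \<cdot> h) w)" for \<sigma> w
  proof -
    have "h (\<sigma> # w) = (1 - \<alpha>) * (f \<cdot> h) (\<sigma> # w)"
      by (simp add: star[symmetric]) (simp add: h_def dirac_def)
    also have "(f \<cdot> h) (\<sigma> # w) = ((\<lambda>u. semantics U (\<sigma> # u)) \<cdot> h) w"
      using f(2) by (simp add: cauchy_Cons U(2))
    finally show ?thesis
      by (simp add: semantics_Cons cauchy_sum_left cauchy_scale_left)
  qed
  have "0 \<le> (\<Sum>r\<in>states U. init U r * trans U \<sigma> r q)" if "q \<in> states U" for \<sigma> q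
    using U(1) that by (auto simp: weighted_automaton_def intro!: sum_nonneg mult_nonneg_nonneg)
  then have "weighted_automaton W"
    using U(1) \<alpha> by (auto simp: W_def weighted_automaton_def)
  have vec: "word_vec W w p = ((\<lambda>u. word_vec U u p) \<cdot> h) w" for w p
  proof (induction w arbitrary: p)
    case Nil
    show ?case
      by (simp add: W_def h_Nil)
  next
    case (Cons \<sigma> w)
    have "((\<lambda>u. word_vec U u p) \<cdot> h) (\<sigma> # w) =
        final U p * h (\<sigma> # w) + (\<Sum>q\<in>states U. trans U \<sigma> p q * ((\<lambda>u. word_vec U u q) \<cdot> h) w)"
      by (simp add: cauchy_Cons cauchy_sum_left cauchy_scale_left)
    also have "\<dots> = word_vec W (\<sigma> # w) p"
      unfolding h_Cons Cons[symmetric]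
      by (simp add: W_def distrib_right sum.distrib mult.assoc)
        (simp add: sum_distrib_left mult.assoc)
    finally show ?case
      by simp
  qed
  have "semantics W w = ?star w" for w
  proof -
    have "semantics W w = (\<Sum>p\<in>states U. init U p * word_vec W w p)"
      by (simp add: semantics_def W_def)
    also have "\<dots> = (f \<cdot> h) w"
      unfolding vec U(2) semantics_def[abs_def] by (simp add: cauchy_sum_left cauchy_scale_left)
    finally show ?thesis
      unfolding star[symmetric] .
  qed
  then have "semantics W = ?star"
    by blast
  then show ?thesis
    using stochastic_regularI[OF \<open>weighted_automaton W\<close>] stochastic_discounted_star[of f \<alpha>] f \<alpha>
    by (auto simp: stochastic_regular_def)
qed

subsection \<open>Gaussian elimination in a closed class\<close>

text \<open>The languages of the cone below vanish at the empty word, so the value there is split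
  off and treated separately.\<close>

definition nonempty_part :: "'a qlang \<Rightarrow> 'a qlang" where
  "nonempty_part f w = (if w = [] then 0 else f w)"

locale closed_class =
  fixes C :: "('a :: finite) qlang set"
  assumes letters: "letter_diracs \<subseteq> C" and closed: "closed_under_ops C"
begin

text \<open>Scalars are needed because \<open>C\<close> is closed only under operations on
  stochastic languages, while the coefficients of a system have arbitrary finite mass. The condition
  at the empty word makes the star applicable.\<close>

definition cone :: "'a qlang set" where
  "cone = {\<lambda>w. c * f w | c f. 0 \<le> c \<and> f \<in> C \<and> stochastic f \<and> f [] = 0}"

lemma coneE:
  assumes "g \<in> cone"
  obtains c f where "0 \<le> c" "f \<in> C" "stochastic f" "f [] = 0" "g = (\<lambda>w. c * f w)"
  using assms by (auto simp: cone_def)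

lemma coneI: "0 \<le> c \<Longrightarrow> f \<in> C \<Longrightarrow> stochastic f \<Longrightarrow> f [] = 0 \<Longrightarrow> (\<lambda>w. c * f w) \<in> cone"
  by (auto simp: cone_def)

lemma cone_nonneg: "g \<in> cone \<Longrightarrow> 0 \<le> g w"
  by (auto elim!: coneE simp: stochastic_def)

lemma cone_dirac: "dirac [\<sigma>] \<in> cone"
proof -
  have "dirac [\<sigma>] [] = 0"
    by (simp add: dirac_def)
  then show ?thesis
    using coneI[of 1 "dirac [\<sigma>]"] letters stochastic_dirac[of "[\<sigma>]"] by auto
qed

lemma cone_scale: "0 \<le> k \<Longrightarrow> g \<in> cone \<Longrightarrow> (\<lambda>w. k * g w) \<in> cone"
  by (elim coneE) (use coneI[of "k * _"] in \<open>auto simp: mult.assoc\<close>)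

text \<open>Zero times the Dirac language of some letter; a letter exists because types are
  inhabited.\<close>

lemma cone_zero: "(\<lambda>w. 0) \<in> cone"
  using cone_scale[OF _ cone_dirac, of 0] by simp

text \<open>A sum with masses \<open>c\<close> and \<open>d\<close> is \<open>c + d\<close> times
  the convex combination with parameter \<open>c / (c + d)\<close>. This lies strictly between 0 and
  1 only if both masses are positive.\<close>

lemma cone_add:
  assumes "f \<in> cone" "g \<in> cone"
  shows "(\<lambda>w. f w + g w) \<in> cone"
proof -
  obtain c f' where f: "0 \<le> c" "f' \<in> C" "stochastic f'" "f' [] = 0" "f = (\<lambda>w. c * f' w)"
    using assms(1) by (rule coneE)
  obtain d g' where g: "0 \<le> d" "g' \<in> C" "stochastic g'" "g' [] = 0" "g = (\<lambda>w. d * g' w)"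
    using assms(2) by (rule coneE)
  consider "c = 0" | "d = 0" | "0 < c" "0 < d"
    using f(1) g(1) by fastforce
  then show ?thesis
  proof cases
    case 3
    define \<alpha> where "\<alpha> = c / (c + d)"
    have \<alpha>: "0 < \<alpha>" "\<alpha> < 1" "(c + d) * \<alpha> = c" "(c + d) * (1 - \<alpha>) = d"
      using 3 by (simp_all add: \<alpha>_def field_simps)
    have "convex_comb \<alpha> f' g' \<in> C"
      using closed f g \<alpha> by (auto simp: closed_under_ops_def)
    moreover have "convex_comb \<alpha> f' g' [] = 0"
      using f g by (simp add: convex_comb_def)
    ultimately have "(\<lambda>w. (c + d) * convex_comb \<alpha> f' g' w) \<in> cone"
      using stochastic_convex_comb[of f' g' \<alpha>] f g \<alpha> by (intro coneI) auto
    moreover have "(c + d) * convex_comb \<alpha> f' g' w = f w + g w" for w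
      unfolding convex_comb_def distrib_left mult.assoc[symmetric] \<alpha> f g by simp
    ultimately show ?thesis
      by simp
  qed (use assms f g in auto)
qed

lemma cone_sum: "(\<And>i. i \<in> I \<Longrightarrow> f i \<in> cone) \<Longrightarrow> (\<lambda>w. \<Sum>i\<in>I. f i w) \<in> cone"
  by (induction I rule: infinite_finite_induct) (simp_all add: cone_zero cone_add)

lemma cone_cauchy:
  assumes "f \<in> cone" "g \<in> cone"
  shows "f \<cdot> g \<in> cone"
proof -
  obtain c f' where f: "0 \<le> c" "f' \<in> C" "stochastic f'" "f' [] = 0" "f = (\<lambda>w. c * f' w)"
    using assms(1) by (rule coneE)
  obtain d g' where g: "0 \<le> d" "g' \<in> C" "stochastic g'" "g' [] = 0" "g = (\<lambda>w. d * g' w)"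
    using assms(2) by (rule coneE)
  have "f' \<cdot> g' \<in> C"
    using closed f g by (auto simp: closed_under_ops_def)
  then have "(\<lambda>w. c * d * (f' \<cdot> g') w) \<in> cone"
    using stochastic_cauchy[of f' g'] f g by (intro coneI) auto
  moreover have "f \<cdot> g = (\<lambda>w. c * d * (f' \<cdot> g') w)"
    unfolding f(5) g(5) by (auto simp: cauchy_scale_left cauchy_scale_right)
  ultimately show ?thesis
    by simp
qed

text \<open>Existence in Arden's rule, with \<open>p\<close> in the role of
  \<open>a + a \<cdot> a + ...\<close>. Only nonnegativity is asked of \<open>b\<close>, since
  during elimination it still contains unsolved unknowns.\<close>

lemma cone_arden:
  assumes "a \<in> cone" and b: "\<And>w. 0 \<le> b w" and f: "has_mass f m" "f \<noteq> (\<lambda>w. 0)"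
    and eq: "\<And>w. f w = b w + (a \<cdot> f) w"
  shows "\<exists>p\<in>cone. f = (\<lambda>w. b w + (p \<cdot> b) w)"
proof -
  obtain c g where g: "0 \<le> c" "g \<in> C" "stochastic g" "g [] = 0" and a: "a = (\<lambda>w. c * g w)"
    using assms(1) by (rule coneE)
  have "has_mass a c"
    using has_mass_scale[of g 1 c] g by (simp add: a stochastic_iff_has_mass)
  then have "has_mass (a \<cdot> f) (c * m)"
    using f(1) by (rule has_mass_cauchy)
  then have "((\<lambda>w. f w + - (a \<cdot> f) w) has_sum (m + - (c * m))) UNIV"
    using f(1) unfolding has_mass_def by (intro has_sum_add) (simp_all add: has_sum_uminus)
  \<comment> \<open>The mass \<open>(1 - c) * m\<close> of \<open>b\<close> is nonnegative and
    \<open>m\<close> is positive, whence \<open>c \<le> 1\<close>.\<close>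
  then have b_mass: "has_mass b (m - c * m)"
    using b eq by (simp add: has_mass_def)
  have "m \<noteq> 0"
    using f has_mass_zero_iff by blast
  then have "0 < m"
    using has_mass_nonneg[OF f(1)] by simp
  moreover have "0 \<le> (1 - c) * m"
    using has_mass_nonneg[OF b_mass] by (simp add: algebra_simps)
  ultimately have "c \<le> 1"
    by (simp add: zero_le_mult_iff)
  have a_Nil: "a [] = 0"
    by (simp add: a g)
  \<comment> \<open>For \<open>c = 1\<close> the mass of \<open>b\<close> is 0, and
    \<open>f = a \<cdot> f\<close> has only the zero solution.\<close>
  have "c \<noteq> 1"
  proof
    assume "c = 1"
    then have "b = (\<lambda>w. 0)"
      using b_mass by (simp add: has_mass_zero_iff)
    then have "f = (\<lambda>w. 0)"
      using eq by (intro arden_unique[where a = a and b = b]) (auto simp: a_Nil cauchy_zero_right)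
    with f show False
      by simp
  qed
  show ?thesis
  proof (cases "c = 0")
    case True
    then have "f = (\<lambda>w. b w + ((\<lambda>w. 0) \<cdot> b) w)"
      using eq by (auto simp: a cauchy_zero_left)
    then show ?thesis
      using cone_zero by blast
  next
    case False
    then have c: "0 < c" "c < 1"
      using g(1) \<open>c \<noteq> 1\<close> \<open>c \<le> 1\<close> by auto
    let ?star = "discounted_star (1 - c) g"
    \<comment> \<open>The star weights the k-th power of \<open>g\<close> by
      \<open>(1 - c) * c ^ (k - 1)\<close>; the factor \<open>c / (1 - c)\<close> turns this into
      \<open>c ^ k\<close>, so \<open>p\<close> sums the positive powers of
      \<open>a\<close>.\<close>
    define p where "p = (\<lambda>w. c / (1 - c) * ?star w)"
    have "?star \<in> C"
      using closed g c by (auto simp: closed_under_ops_def)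
    then have "p \<in> cone"
      unfolding p_def using stochastic_discounted_star[of g "1 - c"] discounted_star_Nil[of g] g c
      by (intro coneI) auto
    have p: "p = (\<lambda>w. a w + (a \<cdot> p) w)"
    proof
      fix w
      have "p w = c / (1 - c) * ((1 - c) * g w + c * (g \<cdot> ?star) w)"
        using discounted_star_unfold[where f = g, OF g(4), of "1 - c" w] by (simp add: p_def)
      also have "\<dots> = c * g w + c * (c / (1 - c) * (g \<cdot> ?star) w)"
        using c by (simp add: field_simps)
      also have "\<dots> = a w + (a \<cdot> p) w"
        by (simp only: a p_def cauchy_scale_left cauchy_scale_right)
      finally show "p w = a w + (a \<cdot> p) w" .
    qed
    have pb: "(p \<cdot> b) w = (a \<cdot> b) w + (a \<cdot> (p \<cdot> b)) w" for w
      by (subst p) (simp add: cauchy_add_left cauchy_assoc)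
    have "b w + (p \<cdot> b) w = b w + (a \<cdot> (\<lambda>w. b w + (p \<cdot> b) w)) w" for w
      unfolding cauchy_add_right using pb[of w] by simp
    then have "f = (\<lambda>w. b w + (p \<cdot> b) w)"
      by (intro arden_unique[OF a_Nil eq])
    with \<open>p \<in> cone\<close> show ?thesis
      by blast
  qed
qed

text \<open>Induction on the set of unknowns: Arden's rule solves for \<open>r\<close>, the result
  is substituted into the other equations, and \<open>r\<close> is recovered last. The solution
  \<open>f\<close> stays fixed while \<open>a\<close> and \<open>b\<close> change.\<close>

lemma cone_linear_system:
  assumes "finite S"
    and "\<And>p q. p \<in> S \<Longrightarrow> q \<in> S \<Longrightarrow> a p q \<in> cone" and "\<And>p. p \<in> S \<Longrightarrow> b p \<in> cone"
    and "\<And>p. p \<in> S \<Longrightarrow> \<exists>m. has_mass (f p) m" and "\<And>p. p \<in> S \<Longrightarrow> f p \<noteq> (\<lambda>w. 0)"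
    and "\<And>p w. p \<in> S \<Longrightarrow> f p w = b p w + (\<Sum>q\<in>S. (a p q \<cdot> f q) w)"
    and "p \<in> S"
  shows "f p \<in> cone"
  using assms
proof (induction S arbitrary: a b p rule: finite_induct)
  case (insert r S)
  note a = insert.prems(1) and b = insert.prems(2) and eq = insert.prems(5)
  have mass: "\<exists>m. has_mass (f p) m" if "p \<in> insert r S" for p
    using insert.prems(3) that by blast
  define rest where "rest = (\<lambda>w. b r w + (\<Sum>q\<in>S. (a r q \<cdot> f q) w))"
  have "0 \<le> rest w" for w
    unfolding rest_def using a b mass
    by (intro add_nonneg_nonneg sum_nonneg cauchy_nonneg) (auto simp: cone_nonneg has_mass_def)
  moreover have "f r w = rest w + (a r r \<cdot> f r) w" for w
    using eq[of r w] insert.hyps by (simp add: rest_def)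
  ultimately obtain s where s: "s \<in> cone" and f_r: "f r = (\<lambda>w. rest w + (s \<cdot> rest) w)"
    using cone_arden[of "a r r" rest "f r"] a mass[of r] insert.prems(4)[of r] by blast
  \<comment> \<open>Substituting for \<open>f r\<close> turns its coefficient \<open>a p r\<close>
    in row \<open>p\<close> into the coefficient \<open>a p r + a p r \<cdot> s\<close> of
    \<open>rest\<close>.\<close>
  define d where "d p = (\<lambda>w. a p r w + (a p r \<cdot> s) w)" for p
  have d: "d p \<in> cone" if "p \<in> S" for p
    unfolding d_def using that a s by (intro cone_add cone_cauchy) auto
  have d_rest: "a p r \<cdot> f r = d p \<cdot> rest" for p
    unfolding f_r d_def by (auto simp: cauchy_add_left cauchy_add_right cauchy_assoc)
  have IH: "f p \<in> cone" if "p \<in> S" for p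
  proof (rule insert.IH[where a = "\<lambda>p q w. a p q w + (d p \<cdot> a r q) w"
        and b = "\<lambda>p w. b p w + (d p \<cdot> b r) w"])
    show "f p w = b p w + (d p \<cdot> b r) w + (\<Sum>q\<in>S. ((\<lambda>w. a p q w + (d p \<cdot> a r q) w) \<cdot> f q) w)"
      if "p \<in> S" for p w
    proof -
      have "f p w = b p w + (d p \<cdot> rest) w + (\<Sum>q\<in>S. (a p q \<cdot> f q) w)"
        using eq[of p w] insert.hyps that by (simp add: d_rest)
      also have "(d p \<cdot> rest) w = (d p \<cdot> b r) w + (\<Sum>q\<in>S. (d p \<cdot> a r q \<cdot> f q) w)"
        by (simp add: rest_def cauchy_add_right cauchy_sum_right cauchy_assoc)
      finally show ?thesis
        by (simp add: cauchy_add_left sum.distrib)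
    qed
  qed (use a b d mass insert.prems(4) that in \<open>auto intro!: cone_add cone_cauchy\<close>)
  \<comment> \<open>Back substitution: the unknowns occurring in \<open>rest\<close> are solved by
    now.\<close>
  have "rest \<in> cone"
    unfolding rest_def using a b IH by (intro cone_add cone_sum cone_cauchy) auto
  then have "f r \<in> cone"
    unfolding f_r using s by (intro cone_add cone_cauchy)
  with IH insert.prems(6) show ?case
    by blast
qed simp

section \<open>From automata to linear systems\<close>

lemma nonempty_part_semantics_in_cone:
  assumes W: "weighted_automaton W" and summable: "semantics W summable_on UNIV"
  shows "nonempty_part (semantics W) \<in> cone"
proof -
  let ?Q = "states W"
  define F where "F p = nonempty_part (\<lambda>w. word_vec W w p)" for p
  define a where "a p q = (\<lambda>w. \<Sum>\<sigma>\<in>UNIV. trans W \<sigma> p q * dirac [\<sigma>] w)" for p q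
  \<comment> \<open>\<open>F q\<close> omits the empty word, so runs that accept after a single
    letter are collected here.\<close>
  define b where "b p = (\<lambda>w. \<Sum>q\<in>?Q. final W q * a p q w)" for p
  \<comment> \<open>Arden's rule needs nonzero unknowns of finite mass. The other states must be
    shown to contribute neither to the equations of \<open>S\<close> nor to the semantics.\<close>
  define S where "S = {p \<in> ?Q. F p summable_on UNIV \<and> F p \<noteq> (\<lambda>w. 0)}"
  have fin: "finite ?Q"
    using W by (simp add: weighted_automaton_def)
  have weights: "0 \<le> init W p" "0 \<le> final W p" "q \<in> ?Q \<Longrightarrow> 0 \<le> trans W \<sigma> p q"
    if "p \<in> ?Q" for p q \<sigma>
    using W that by (auto simp: weighted_automaton_def)
  have F_nonneg: "0 \<le> F p w" if "p \<in> ?Q" for p w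
    using word_vec_nonneg[OF W that] by (simp add: F_def nonempty_part_def)
  have a_cone: "a p q \<in> cone" if "p \<in> ?Q" "q \<in> ?Q" for p q
    unfolding a_def using that weights by (intro cone_sum cone_scale cone_dirac) auto
  have b_cone: "b p \<in> cone" if "p \<in> ?Q" for p
    unfolding b_def using that weights a_cone by (intro cone_sum cone_scale) auto
  have a_Cons: "(a p q \<cdot> f) (\<sigma> # w) = trans W \<sigma> p q * f w" for p q f \<sigma> w
    by (simp add: a_def cauchy_sum_left cauchy_scale_left cauchy_dirac_letter_Cons if_distrib
        cong: if_cong)
  have a_letter: "a p q (\<sigma> # w) = (if w = [] then trans W \<sigma> p q else 0)" for p q \<sigma> w
    using a_Cons[of p q "dirac []" \<sigma> w] by (simp add: cauchy_dirac_Nil_right dirac_def)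
  have system: "F p w = b p w + (\<Sum>q\<in>?Q. (a p q \<cdot> F q) w)" for p w
  proof (cases w)
    case Nil
    then show ?thesis
      by (simp add: F_def nonempty_part_def b_def a_def dirac_def)
  next
    case (Cons \<sigma> v)
    then show ?thesis
      by (simp add: a_Cons b_def a_letter F_def nonempty_part_def flip: sum.distrib)
        (auto simp: mult.commute intro!: sum.cong)
  qed
  \<comment> \<open>Finite mass propagates along transitions of positive weight.\<close>
  have vanish: "(a p q \<cdot> F q) w = 0" if "p \<in> S" "q \<in> ?Q - S" for p q w
  proof (cases "F q = (\<lambda>w. 0)")
    case True
    then show ?thesis
      by (simp add: cauchy_zero_right)
  next
    case False
    then have not_summable: "\<not> F q summable_on UNIV"
      using that by (auto simp: S_def)
    have p: "p \<in> ?Q" "F p summable_on UNIV"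
      using that by (auto simp: S_def)
    have "trans W \<sigma> p q = 0" for \<sigma>
    proof (rule ccontr)
      assume nz: "trans W \<sigma> p q \<noteq> 0"
      \<comment> \<open>On words beginning with \<open>\<sigma>\<close>, \<open>F p\<close>
        dominates a positive multiple of \<open>F q\<close>, which would make \<open>F q\<close>
        summable.\<close>
      have "F p summable_on range (Cons \<sigma>)"
        by (rule summable_on_subset_banach[OF p(2)]) simp
      then have "(\<lambda>v. F p (\<sigma> # v)) summable_on UNIV"
        by (subst (asm) summable_on_reindex) (auto simp: o_def)
      then have "(\<lambda>v. trans W \<sigma> p q * F q v) summable_on UNIV"
      proof (rule summable_on_comparison_test)
        fix v
        have terms: "0 \<le> (a p r \<cdot> F r) (\<sigma> # v)" if "r \<in> ?Q" for r
          using a_cone p that F_nonneg by (intro cauchy_nonneg) (auto simp: cone_nonneg)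
        have "trans W \<sigma> p q * F q v \<le> (\<Sum>r\<in>?Q. (a p r \<cdot> F r) (\<sigma> # v))"
          using member_le_sum[of q ?Q "\<lambda>r. (a p r \<cdot> F r) (\<sigma> # v)"] terms fin that(2)
          by (auto simp: a_Cons)
        then show "trans W \<sigma> p q * F q v \<le> F p (\<sigma> # v)"
          using cone_nonneg[OF b_cone[OF p(1)], of "\<sigma> # v"] system[of p "\<sigma> # v"] by linarith
        show "0 \<le> trans W \<sigma> p q * F q v"
          using weights(3) p that F_nonneg by auto
      qed
      then show False
        using not_summable nz by (simp add: summable_on_cmult_right')
    qed
    then have "a p q = (\<lambda>w. 0)"
      by (auto simp: a_def)
    then show ?thesis
      by (simp add: cauchy_zero_left)
  qed
  have "F p \<in> cone" if "p \<in> S" for p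
  proof (rule cone_linear_system[where S = S and a = a and b = b])
    show "\<exists>m. has_mass (F p) m" if "p \<in> S" for p
      using that F_nonneg by (auto simp: S_def has_mass_def summable_on_def)
    show "F p w = b p w + (\<Sum>q\<in>S. (a p q \<cdot> F q) w)" if "p \<in> S" for p w
      unfolding system[of p w] using fin vanish that
      by (auto simp: S_def intro!: sum.mono_neutral_right)
  qed (use fin a_cone b_cone that in \<open>auto simp: S_def\<close>)
  then have "(\<lambda>w. \<Sum>p\<in>S. init W p * F p w) \<in> cone"
    using weights by (intro cone_sum cone_scale) (auto simp: S_def)
  moreover have "nonempty_part (semantics W) w = (\<Sum>p\<in>S. init W p * F p w)" for w
  proof -
    have "nonempty_part (semantics W) w = (\<Sum>p\<in>?Q. init W p * F p w)"
      by (simp add: nonempty_part_def F_def semantics_def)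
    also have "\<dots> = (\<Sum>p\<in>S. init W p * F p w)"
    proof (rule sum.mono_neutral_right)
      show "\<forall>p\<in>?Q - S. init W p * F p w = 0"
      proof
        fix p assume p: "p \<in> ?Q - S"
        show "init W p * F p w = 0"
        proof (rule ccontr)
          assume nz: "init W p * F p w \<noteq> 0"
          \<comment> \<open>A nonzero initial weight would bound a multiple of \<open>F p\<close> by
            the summable semantics, putting \<open>p\<close> into \<open>S\<close>.\<close>
          have "(\<lambda>w. init W p * F p w) summable_on UNIV"
          proof (rule summable_on_comparison_test[OF summable])
            fix w
            have "init W p * word_vec W w p \<le> semantics W w"
              unfolding semantics_def using p fin weights word_vec_nonneg[OF W]
              by (intro member_le_sum[of p ?Q "\<lambda>p. init W p * word_vec W w p"]) auto
            moreover have "F p w \<le> word_vec W w p"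
              using p word_vec_nonneg[OF W, of p w] by (cases w) (simp_all add: F_def nonempty_part_def)
            ultimately show "init W p * F p w \<le> semantics W w"
              using weights(1)[of p] p mult_left_mono by fastforce
            show "0 \<le> init W p * F p w"
              using p weights F_nonneg by simp
          qed
          then show False
            using p nz by (auto simp: S_def summable_on_cmult_right')
        qed
      qed
    qed (use fin in \<open>auto simp: S_def\<close>)
    finally show ?thesis .
  qed
  ultimately show ?thesis
    by presburger
qed

text \<open>Comparing masses, \<open>f\<close> is a mixture of \<open>dirac []\<close> with weight
  \<open>f []\<close> and of a stochastic member of \<open>C\<close>. The disjunction in the
  hypothesis serves both characterisations.\<close>

lemma stochastic_regular_in_class:
  assumes f: "f \<in> stochastic_regular" and empty_word: "f [] = 0 \<or> dirac [] \<in> C"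
  shows "f \<in> C"
proof -
  obtain W :: "(nat, 'a) weighted_automaton" where W: "weighted_automaton W" "f = semantics W"
    using f by (auto simp: stochastic_regular_def)
  have st: "stochastic f"
    using f by (simp add: stochastic_regular_def)
  then have "nonempty_part f \<in> cone"
    using nonempty_part_semantics_in_cone[OF W(1)] W(2) by (auto simp: stochastic_def summable_on_def)
  then obtain c g where g: "0 \<le> c" "g \<in> C" "stochastic g" "g [] = 0"
    and cg: "nonempty_part f = (\<lambda>w. c * g w)"
    by (rule coneE)
  have split: "(\<lambda>w. f [] * dirac [] w + c * g w) = f"
  proof
    show "f [] * dirac [] w + c * g w = f w" for w
      using fun_cong[OF cg, of w] g(4)
      by (cases "w = []") (simp_all add: nonempty_part_def dirac_def)
  qed
  have "0 \<le> f []"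
    using st by (simp add: stochastic_def)
  then have "has_mass (\<lambda>w. f [] * dirac [] w + c * g w) (f [] * 1 + c * 1)"
    using g stochastic_dirac[of "[] :: 'a list"]
    by (intro has_mass_add has_mass_scale) (auto simp: stochastic_iff_has_mass)
  then have total: "f [] + c = 1"
    using has_mass_unique[of f] st by (simp add: split stochastic_iff_has_mass)
  \<comment> \<open>Convex combinations exclude the weights 0 and 1, so the degenerate mixtures are
    separate cases.\<close>
  consider "f [] = 0" "c = 1" | "f [] = 1" "c = 0" | "0 < f []" "f [] < 1" "1 - f [] = c"
    using total g(1) \<open>0 \<le> f []\<close> by fastforce
  then show ?thesis
  proof cases
    case 1
    then have "f = g"
      using split by simp
    then show ?thesis
      using g(2) by simp
  next
    case 2
    then have "f = dirac []"
      using split by simp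
    then show ?thesis
      using 2 empty_word by simp
  next
    case 3
    have "convex_comb (f []) (dirac []) g = f"
      unfolding convex_comb_def[abs_def] 3(3) by (rule split)
    moreover have "convex_comb (f []) (dirac []) g \<in> C"
      using closed g 3 empty_word stochastic_dirac[of "[] :: 'a list"]
      by (auto simp: closed_under_ops_def)
    ultimately show ?thesis
      by simp
  qed
qed

end

section \<open>The two least closed classes\<close>

lemma closed_under_ops_stochastic_regular: "closed_under_ops stochastic_regular"
  by (simp add: closed_under_ops_def stochastic_regular_convex_comb stochastic_regular_cauchy
      stochastic_regular_discounted_star)

theorem theorem6:
  "is_smallest_closed_class (letter_diracs :: ('a :: finite) qlang set)
     {f \<in> stochastic_regular. f [] = 0} \<and>
   is_smallest_closed_class (insert (dirac []) (letter_diracs :: 'a qlang set))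
     stochastic_regular"
proof -
  have minimal: "f \<in> C"
    if "letter_diracs \<subseteq> C" "closed_under_ops C" "f \<in> stochastic_regular" "f [] = 0 \<or> dirac [] \<in> C"
    for C and f :: "'a qlang"
    using closed_class.stochastic_regular_in_class[of C f] that by (simp add: closed_class_def)
  have "closed_under_ops {f \<in> stochastic_regular. f [] = (0 :: real)}"
    using closed_under_ops_stochastic_regular
    by (auto simp: closed_under_ops_def convex_comb_def discounted_star_Nil)
  then show ?thesis
    using closed_under_ops_stochastic_regular stochastic_regular_dirac_letter
      dirac_Nil_stochastic_regular minimal
    unfolding is_smallest_closed_class_def by (auto simp: dirac_def)
qed

end
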